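(* Let $k\geq 2$ be an integer and let $F$ be a finite graph with vertex cover number $\beta(F)\geq k+1$. Then $\mathrm{sat}_k(n,\text{Berge-}F)=O(n)$.
   Context: $\beta(F)$ is the minimum size of a set $A\subseteq V(F)$ such that every edge of $F$ has an endpoint in $A$. For a graph $F$, a hypergraph $H$ is Berge-$F$ if there is a bijection $\phi:E(F)\to E(H)$ with $e\subseteq\phi(e)$ for all $e\in E(F)$ (with $V(F)$ identified with a subset of $V(H)$); a hypergraph contains a Berge-$F$ if some subhypergraph of it is Berge-$F$. A $k$-uniform hypergraph on $n$ vertices is Berge-$F$-saturated if it contains no Berge-$F$ but adding any new $k$-element hyperedge creates one. $\mathrm{sat}_k(n,\text{Berge-}F)$ is the minimum number of hyperedges in a $k$-uniform Berge-$F$-saturated hypergraph on $n$ vertices. *)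

theory Defs
  imports Complex_Main "HOL-Library.Landau_Symbols"
begin

text \<open>A hypergraph is a pair of a vertex set and a set of hyperedges; there are no repeated
  hyperedges. A simple graph is a 2-uniform hypergraph.\<close>

type_synonym 'a hypergraph = "'a set \<times> 'a set set"

abbreviation verts :: "'a hypergraph \<Rightarrow> 'a set" where "verts \<equiv> fst"
abbreviation edges :: "'a hypergraph \<Rightarrow> 'a set set" where "edges \<equiv> snd"

definition finite_hypergraph :: "'a hypergraph \<Rightarrow> bool" where
  "finite_hypergraph H \<longleftrightarrow> finite (verts H) \<and> (\<forall>e\<in>edges H. e \<subseteq> verts H)"

definition uniform_hypergraph :: "nat \<Rightarrow> 'a hypergraph \<Rightarrow> bool" where
  "uniform_hypergraph k H \<longleftrightarrow> finite_hypergraph H \<and> (\<forall>e\<in>edges H. card e = k)"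

abbreviation finite_graph :: "'a hypergraph \<Rightarrow> bool" where
  "finite_graph \<equiv> uniform_hypergraph 2"

definition subhypergraph :: "'a hypergraph \<Rightarrow> 'a hypergraph \<Rightarrow> bool" where
  "subhypergraph H' H \<longleftrightarrow>
     finite_hypergraph H' \<and> verts H' \<subseteq> verts H \<and> edges H' \<subseteq> edges H"

definition vertex_cover :: "'a hypergraph \<Rightarrow> 'a set \<Rightarrow> bool" where
  "vertex_cover F A \<longleftrightarrow> A \<subseteq> verts F \<and> (\<forall>e\<in>edges F. e \<inter> A \<noteq> {})"

definition vertex_cover_number :: "'a hypergraph \<Rightarrow> nat" where
  "vertex_cover_number F = (LEAST m. \<exists>A. vertex_cover F A \<and> card A = m)"

text \<open>The injection \<open>f\<close> is the identification of the vertices of \<open>F\<close> with vertices of \<open>H\<close>.\<close>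

definition is_Berge :: "'a hypergraph \<Rightarrow> 'b hypergraph \<Rightarrow> bool" where
  "is_Berge F H \<longleftrightarrow>
     (\<exists>f \<phi>. inj_on f (verts F) \<and> f ` verts F \<subseteq> verts H \<and>
            bij_betw \<phi> (edges F) (edges H) \<and> (\<forall>e\<in>edges F. f ` e \<subseteq> \<phi> e))"

definition contains_Berge :: "'a hypergraph \<Rightarrow> 'b hypergraph \<Rightarrow> bool" where
  "contains_Berge F H \<longleftrightarrow> (\<exists>H'. subhypergraph H' H \<and> is_Berge F H')"

definition Berge_saturated :: "nat \<Rightarrow> 'a hypergraph \<Rightarrow> 'b hypergraph \<Rightarrow> bool" where
  "Berge_saturated k F H \<longleftrightarrow> uniform_hypergraph k H \<and> \<not> contains_Berge F H \<and>
     (\<forall>e. e \<subseteq> verts H \<and> card e = k \<and> e \<notin> edges H \<longrightarrow>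
          contains_Berge F (verts H, insert e (edges H)))"

text \<open>Taking vertices in \<open>nat\<close> loses nothing up to isomorphism. The minimum exists whenever
  \<open>F\<close> has an edge, see \<open>Berge_sat_attained\<close> below.\<close>

definition Berge_sat :: "nat \<Rightarrow> nat \<Rightarrow> 'a hypergraph \<Rightarrow> nat" where
  "Berge_sat k n F =
     (LEAST m. \<exists>H :: nat hypergraph.
        Berge_saturated k F H \<and> card (verts H) = n \<and> card (edges H) = m)"

lemma vertex_cover_number_attained:
  assumes "finite_graph F"
  shows "\<exists>A. vertex_cover F A \<and> card A = vertex_cover_number F"
proof -
  have "e \<inter> verts F \<noteq> {}" if "e \<in> edges F" for e
  proof -
    have "e \<subseteq> verts F" "card e = 2"
      using assms that by (auto simp: uniform_hypergraph_def finite_hypergraph_def)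
    then show ?thesis by (metis card.empty inf.absorb1 zero_neq_numeral)
  qed
  then have "vertex_cover F (verts F)" by (simp add: vertex_cover_def)
  then show ?thesis
    unfolding vertex_cover_number_def
    by - (rule LeastI[where k = "card (verts F)"], rule exI[of _ "verts F"], simp)
qed

lemma Berge_saturated_exists:
  assumes F: "edges F \<noteq> {}"
  shows "\<exists>H :: nat hypergraph. Berge_saturated k F H \<and> card (verts H) = n"
proof -
  define S where "S = {E. uniform_hypergraph k ({..<n}, E) \<and> \<not> contains_Berge F ({..<n}, E)}"
  have "S \<subseteq> Pow (Pow {..<n})"
    by (auto simp: S_def uniform_hypergraph_def finite_hypergraph_def)
  then have fin: "finite S" by (rule finite_subset) simp
  have "\<not> is_Berge F H'" if "edges H' = {}" for H' :: "nat hypergraph"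
    using F that bij_betw_empty2 unfolding is_Berge_def by metis
  then have "\<not> contains_Berge F (({..<n}, {}) :: nat hypergraph)"
    unfolding contains_Berge_def subhypergraph_def by (metis snd_conv subset_empty)
  then have "{} \<in> S"
    by (simp add: S_def uniform_hypergraph_def finite_hypergraph_def)
  then obtain E where E: "E \<in> S" and maxE: "\<And>E'. E' \<in> S \<Longrightarrow> E \<subseteq> E' \<Longrightarrow> E' = E"
    using finite_has_maximal[OF fin] by (metis empty_iff)
  have "Berge_saturated k F ({..<n}, E)"
    unfolding Berge_saturated_def
  proof (intro conjI allI impI)
    show "uniform_hypergraph k ({..<n}, E)" "\<not> contains_Berge F ({..<n}, E)"
      using E by (auto simp: S_def)
    fix e
    assume e: "e \<subseteq> verts ({..<n}, E) \<and> card e = k \<and> e \<notin> edges ({..<n}, E)"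
    then have "insert e E \<notin> S" using maxE[of "insert e E"] by auto
    moreover have "uniform_hypergraph k ({..<n}, insert e E)"
      using E e by (auto simp: S_def uniform_hypergraph_def finite_hypergraph_def)
    ultimately show "contains_Berge F (verts ({..<n}, E), insert e (edges ({..<n}, E)))"
      by (simp add: S_def)
  qed
  then show ?thesis by (intro exI[of _ "({..<n}, E)"]) simp
qed

lemma Berge_sat_attained:
  assumes "edges F \<noteq> {}"
  shows "\<exists>H :: nat hypergraph.
    Berge_saturated k F H \<and> card (verts H) = n \<and> card (edges H) = Berge_sat k n F"
proof -
  obtain H :: "nat hypergraph" where "Berge_saturated k F H" "card (verts H) = n"
    using Berge_saturated_exists[OF assms] by blast
  then show ?thesis
    unfolding Berge_sat_def
    by - (rule LeastI[where k = "card (edges H)"], rule exI[of _ H], simp)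
qed

end

theory Submission
  imports Defs
begin

text \<open>Let \<open>A\<close> be a set of \<open>\<beta>(F) - 1 \<ge> k\<close> vertices and start from the core: all \<open>k\<close>-sets with at
  most one vertex outside \<open>A\<close>. In a Berge-\<open>F\<close> inside the core the preimage of \<open>A\<close> would be a vertex
  cover of \<open>F\<close>, so the core is Berge-\<open>F\<close>-free, and it has \<open>O(n)\<close> edges. Extend it to a saturated
  hypergraph. If some \<open>v \<notin> A\<close> lay in very many non-core edges, these would contain many distinct
  edges through \<open>v\<close> with distinct representatives outside \<open>A \<union> {v}\<close>. Mapping a minimum cover
  \<open>C\<close> minus a vertex \<open>w\<close> to \<open>A\<close>, \<open>w\<close> to \<open>v\<close>, and the remaining vertices to the
  representatives yields a Berge-\<open>F\<close>: edges between \<open>C - {w}\<close> and the rest are represented in the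
  core because \<open>|A| \<ge> k\<close> lets us choose distinct \<open>(k-1)\<close>-subsets of \<open>A\<close> through its points.
  Hence every \<open>v \<notin> A\<close> has bounded degree outside the core.\<close>

section \<open>Building and unpacking Berge copies\<close>

lemma contains_BergeI:
  assumes "finite_hypergraph H" "inj_on f (verts F)" "f ` verts F \<subseteq> verts H"
    "inj_on \<phi> (edges F)" "\<phi> ` edges F \<subseteq> edges H" "\<And>e. e \<in> edges F \<Longrightarrow> f ` e \<subseteq> \<phi> e"
  shows "contains_Berge F H"
  unfolding contains_Berge_def is_Berge_def
proof (intro exI conjI)
  show "subhypergraph (verts H, \<phi> ` edges F) H"
    using assms(1,5) by (fastforce simp: subhypergraph_def finite_hypergraph_def)
  show "bij_betw \<phi> (edges F) (edges (verts H, \<phi> ` edges F))"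
    using assms(4) by (simp add: inj_on_imp_bij_betw)
  show "\<forall>e\<in>edges F. f ` e \<subseteq> \<phi> e" using assms(6) by blast
qed (use assms(2,3) in simp_all)

lemma contains_BergeE:
  assumes "contains_Berge F H"
  obtains f \<phi> where "inj_on f (verts F)" "f ` verts F \<subseteq> verts H"
    "inj_on \<phi> (edges F)" "\<phi> ` edges F \<subseteq> edges H" "\<And>e. e \<in> edges F \<Longrightarrow> f ` e \<subseteq> \<phi> e"
proof -
  obtain H' f \<phi> where "subhypergraph H' H" "inj_on f (verts F)" "f ` verts F \<subseteq> verts H'"
    "bij_betw \<phi> (edges F) (edges H')" "\<forall>e\<in>edges F. f ` e \<subseteq> \<phi> e"
    using assms unfolding contains_Berge_def is_Berge_def by blast
  then show ?thesis
    by (intro that[of f \<phi>]) (auto simp: subhypergraph_def bij_betw_def)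
qed

section \<open>Systems of distinct sets through prescribed points and pairs\<close>

lemma fixpoint_free_injection_exists:
  assumes "finite A" "card A \<ge> 2"
  shows "\<exists>\<sigma>. inj_on \<sigma> A \<and> \<sigma> ` A \<subseteq> A \<and> (\<forall>a\<in>A. \<sigma> a \<noteq> a)"
proof -
  define s where "s = card A"
  obtain g where g: "bij_betw g A {..<s}"
    using ex_bij_betw_finite_nat[OF assms(1)] by (auto simp: s_def atLeast0LessThan)
  \<comment> \<open>The cyclic shift on \<open>{..<s}\<close>, to be transported to \<open>A\<close>
    along \<open>g\<close>; it has no fixed point because \<open>s\<close> is at least 2.\<close>
  define \<tau> where "\<tau> i = (if Suc i = s then 0 else Suc i)" for i
  have \<tau>: "inj_on \<tau> {..<s}" "\<tau> ` {..<s} \<subseteq> {..<s}" "\<And>i. \<tau> i \<noteq> i"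
    using assms(2) by (auto simp: \<tau>_def s_def inj_on_def split: if_splits)
  have g': "bij_betw (inv_into A g) {..<s} A"
    using g by (rule bij_betw_inv_into)
  show ?thesis
  proof (intro exI conjI ballI)
    have inj: "inj_on (\<tau> \<circ> g) A"
      using g \<tau>(1) by (intro comp_inj_on) (auto simp: bij_betw_def)
    have img: "(\<tau> \<circ> g) ` A \<subseteq> {..<s}"
      using g \<tau>(2) by (auto simp: bij_betw_def)
    have "inj_on (inv_into A g) ((\<tau> \<circ> g) ` A)"
      using g' img by (meson bij_betw_def inj_on_subset)
    with inj show "inj_on (inv_into A g \<circ> (\<tau> \<circ> g)) A"
      by (rule comp_inj_on)
    show "(inv_into A g \<circ> (\<tau> \<circ> g)) ` A \<subseteq> A"
      using g' img by (auto simp: bij_betw_def)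
    fix a assume a: "a \<in> A"
    then have "\<tau> (g a) \<in> g ` A"
      using g \<tau>(2) by (auto simp: bij_betw_def)
    then show "(inv_into A g \<circ> (\<tau> \<circ> g)) a \<noteq> a"
      using \<tau>(3)[of "g a"] by (metis comp_apply f_inv_into_f)
  qed
qed

text \<open>Inside a set \<open>B\<close> of m+1 points, deleting one point at a time gives distinct
  m-sets, and deleting \<open>\<sigma> a\<close> with \<open>\<sigma>\<close> injective and
  fixpoint-free keeps \<open>a\<close>. A point outside \<open>B\<close> joins a fixed set
  \<open>T\<close> of m-1 points of \<open>B\<close> and is then recognised as the only point of its
  set outside \<open>B\<close>.\<close>

lemma distinct_subsets_through_points:
  assumes "finite A" "1 \<le> m" "m < card A"
  shows "\<exists>c. inj_on c A \<and> (\<forall>a\<in>A. a \<in> c a \<and> c a \<subseteq> A \<and> card (c a) = m)"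
proof -
  obtain B where B: "B \<subseteq> A" "card B = Suc m" "finite B"
    using assms(3) by (metis Suc_leI obtain_subset_with_card_n)
  then obtain \<sigma> where \<sigma>: "inj_on \<sigma> B" "\<sigma> ` B \<subseteq> B" "\<And>a. a \<in> B \<Longrightarrow> \<sigma> a \<noteq> a"
    using fixpoint_free_injection_exists[of B] assms(2) by auto
  obtain T where T: "T \<subseteq> B" "card T = m - 1" "finite T"
    using B(2) by (metis diff_le_self le_Suc_eq obtain_subset_with_card_n)
  define c where "c a = (if a \<in> B then B - {\<sigma> a} else insert a T)" for a
  have "inj_on c A"
  proof (rule inj_onI)
    fix a b assume ab: "a \<in> A" "b \<in> A" "c a = c b"
    show "a = b"
    proof (cases "a \<in> B"; cases "b \<in> B")
      assume "a \<in> B" "b \<in> B"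
      then have "\<sigma> a = \<sigma> b" using ab(3) \<sigma>(2) by (auto simp: c_def)
      then show ?thesis using \<sigma>(1) \<open>a \<in> B\<close> \<open>b \<in> B\<close> by (auto dest: inj_onD)
    qed (use ab(3) T in \<open>auto simp: c_def\<close>)
  qed
  moreover have "a \<in> c a \<and> c a \<subseteq> A \<and> card (c a) = m" if a: "a \<in> A" for a
  proof (cases "a \<in> B")
    case True
    then have "\<sigma> a \<in> B" "\<sigma> a \<noteq> a" using \<sigma> by auto
    then show ?thesis using True B by (auto simp: c_def)
  next
    case False
    then have "a \<notin> T" using T by auto
    then show ?thesis using False B T a assms(2) by (auto simp: c_def)
  qed
  ultimately show ?thesis by blast
qed

text \<open>For \<open>k \<ge> 3\<close> each pair gets its own vertex of \<open>Z\<close>; for \<open>k = 2\<close> the pair itself is the only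
  choice.\<close>

lemma distinct_supersets_of_pairs:
  assumes "finite A" "2 \<le> k" "k \<le> card A" "finite D" "\<And>p. p \<in> D \<Longrightarrow> p \<subseteq> A \<and> card p = 2"
    and "finite Z" "card D \<le> card Z" "A \<inter> Z = {}"
  shows "\<exists>\<psi>. inj_on \<psi> D \<and>
    (\<forall>p\<in>D. p \<subseteq> \<psi> p \<and> \<psi> p \<subseteq> A \<union> Z \<and> card (\<psi> p) = k \<and> card (\<psi> p - A) \<le> 1)"
proof (cases "k = 2")
  case True
  have "p - A = {}" if "p \<in> D" for p using assms(5) that by auto
  then have "card (p - A) \<le> 1" if "p \<in> D" for p
    using that by (metis card.empty zero_le)
  then show ?thesis using True assms(5) by (intro exI[of _ id]) auto
next
  case False
  obtain z where z: "inj_on z D" "z ` D \<subseteq> Z"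
    using card_le_inj[OF assms(4,6,7)] by auto
  have "\<exists>T. p \<subseteq> T \<and> T \<subseteq> A \<and> card T = k - 1" if "p \<in> D" for p
    using exists_subset_between[of p "k - 1" A] assms(1-3) assms(5)[OF that] False by fastforce
  then obtain T where T: "\<And>p. p \<in> D \<Longrightarrow> p \<subseteq> T p \<and> T p \<subseteq> A \<and> card (T p) = k - 1"
    by metis
  have z': "z p \<in> Z" "z p \<notin> A" "z p \<notin> T p" "finite (T p)" if "p \<in> D" for p
  proof -
    show "z p \<in> Z" using z(2) that by blast
    then show "z p \<notin> A" using assms(8) by blast
    then show "z p \<notin> T p" using T[OF that] by blast
    show "finite (T p)" using T[OF that] assms(1) finite_subset by blast
  qed
  \<comment> \<open>The private vertex \<open>z p\<close> can be read off as the part outside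
    \<open>A\<close>, so injectivity of \<open>z\<close> carries over to the enlarged sets.\<close>
  have diff: "insert (z p) (T p) - A = {z p}" if "p \<in> D" for p
    using z' T that by blast
  have "inj_on (\<lambda>p. insert (z p) (T p)) D"
  proof (rule inj_onI)
    fix p q assume "p \<in> D" "q \<in> D" "insert (z p) (T p) = insert (z q) (T q)"
    then have "z p = z q" using diff by (metis singleton_inject)
    then show "p = q" using z(1) \<open>p \<in> D\<close> \<open>q \<in> D\<close> by (auto dest: inj_onD)
  qed
  moreover have "card (insert (z p) (T p)) = k" if "p \<in> D" for p
    using z'[OF that] T[OF that] assms(2) by simp
  moreover have "p \<subseteq> insert (z p) (T p) \<and> insert (z p) (T p) \<subseteq> A \<union> Z" if "p \<in> D" for p
    using z'(1)[OF that] T[OF that] by blast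
  ultimately show ?thesis
    using diff by (intro exI[of _ "\<lambda>p. insert (z p) (T p)"]) auto
qed

section \<open>Embedding \<open>F\<close> with the help of a vertex of large non-core degree\<close>

text \<open>The edges of \<open>F\<close> fall into three types, and their hyperedges are told apart
  by the part outside \<open>A\<close>: at most one vertex, lying in \<open>Z\<close>, for edges
  inside \<open>C - {w}\<close>; exactly one vertex, not in \<open>Z\<close>, for edges leaving
  \<open>C - {w}\<close>; at least two vertices for edges from \<open>w\<close> to the complement of
  \<open>C\<close>. Only injectivity within each type remains.\<close>

lemma Berge_embedding:
  fixes H :: "'b hypergraph"
  assumes k: "2 \<le> k" and H: "uniform_hypergraph k H" and F: "finite_graph F"
    and C: "vertex_cover F C" and w: "w \<in> C"
    and A: "A \<subseteq> verts H" "card A = card (C - {w})" "k \<le> card A"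
    and core: "\<And>e. \<lbrakk>e \<subseteq> verts H; card e = k; card (e - A) \<le> 1\<rbrakk> \<Longrightarrow> e \<in> edges H"
    and v: "v \<in> verts H - A"
    and R: "R \<subseteq> verts H - A - {v}" "card R = card (verts F - C)"
    and h: "inj_on h R" "\<And>r. r \<in> R \<Longrightarrow> h r \<in> edges H \<and> r \<in> h r \<and> v \<in> h r"
    and large: "card (verts F) + card (edges F) \<le> card (verts H)"
  shows "contains_Berge F H"
proof -
  have finH: "finite (verts H)" and subH: "\<And>e. e \<in> edges H \<Longrightarrow> e \<subseteq> verts H"
    using H by (auto simp: uniform_hypergraph_def finite_hypergraph_def)
  have finV: "finite (verts F)" and subF: "\<And>e. e \<in> edges F \<Longrightarrow> e \<subseteq> verts F \<and> card e = 2"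
    using F by (auto simp: uniform_hypergraph_def finite_hypergraph_def)
  have finE: "finite (edges F)"
    using subF finV by (intro finite_subset[of "edges F" "Pow (verts F)"]) auto
  have CV: "C \<subseteq> verts F" and cov: "\<And>e. e \<in> edges F \<Longrightarrow> e \<inter> C \<noteq> {}"
    using C by (auto simp: vertex_cover_def)
  define C' where "C' = C - {w}"
  have finA: "finite A" and finR: "finite R" and finC: "finite C"
    using finH A(1) R(1) finV CV by (auto intro: finite_subset)
  obtain f1 where f1: "bij_betw f1 C' A"
    using finite_same_card_bij[of C' A] finA finC A(2) by (auto simp: C'_def)
  obtain f2 where f2: "bij_betw f2 (verts F - C) R"
    using finite_same_card_bij[of "verts F - C" R] finV finR R(2) by auto
  define f where "f x = (if x \<in> C' then f1 x else if x = w then v else f2 x)" for x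
  have fC': "bij_betw f C' A"
    using f1 by (rule iffD1[OF bij_betw_cong, rotated]) (simp add: f_def)
  have fR: "bij_betw f (verts F - C) R"
    using f2 by (rule iffD1[OF bij_betw_cong, rotated]) (use w in \<open>auto simp: f_def C'_def\<close>)
  have fw: "f w = v" by (simp add: f_def C'_def)
  have V: "verts F = C' \<union> ({w} \<union> (verts F - C))" using CV w by (auto simp: C'_def)
  have "bij_betw f ({w} \<union> (verts F - C)) ({v} \<union> R)"
    by (rule bij_betw_combine[OF _ fR]) (use fw R(1) in \<open>auto simp: bij_betw_def\<close>)
  then have "bij_betw f (C' \<union> ({w} \<union> (verts F - C))) (A \<union> ({v} \<union> R))"
    by (rule bij_betw_combine[OF fC']) (use v R(1) in auto)
  then have f: "bij_betw f (verts F) (A \<union> ({v} \<union> R))" using V by simp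
  then have finj: "inj_on f (verts F)" and fimg: "f ` verts F = A \<union> ({v} \<union> R)"
    by (auto simp: bij_betw_def)
  have fVH: "f ` verts F \<subseteq> verts H" using fimg A(1) v R(1) by auto
  have fA: "f x \<in> A \<longleftrightarrow> x \<in> C'" if "x \<in> verts F" for x
  proof
    assume "f x \<in> A"
    then obtain y where "y \<in> C'" "f x = f y" using fC' by (auto simp: bij_betw_def)
    then show "x \<in> C'" using finj that CV by (metis C'_def DiffD1 inj_onD subsetD)
  qed (use fC' in \<open>auto simp: bij_betw_def\<close>)
  define Z where "Z = verts H - f ` verts F"
  have Z: "finite Z" "card (edges F) \<le> card Z" "A \<inter> Z = {}" "Z \<subseteq> verts H"
  proof -
    have "card Z = card (verts H) - card (verts F)"
      using finV fVH finj by (simp add: Z_def card_Diff_subset card_image)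
    then show "card (edges F) \<le> card Z" using large by simp
  qed (use finH fimg in \<open>auto simp: Z_def\<close>)
  define E1 where "E1 = {e \<in> edges F. e \<subseteq> C'}"
  define E2 where "E2 = {e \<in> edges F. \<exists>a\<in>C'. \<exists>x\<in>verts F - C'. e = {a, x}}"
  define E3 where "E3 = {e \<in> edges F. \<exists>x\<in>verts F - C. e = {w, x}}"
  \<comment> \<open>Edges between \<open>C'\<close> and \<open>w\<close> belong to
    \<open>E2\<close>, since \<open>w\<close> lies outside \<open>C'\<close>; so \<open>E3\<close>
    only has edges from \<open>w\<close> to vertices off the cover.\<close>
  have split: "e \<in> E1 \<or> e \<in> E2 \<or> e \<in> E3" if e: "e \<in> edges F" for e
  proof -
    obtain x y where xy: "e = {x, y}" "x \<noteq> y" "x \<in> verts F" "y \<in> verts F" "x \<in> C \<or> y \<in> C"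
      using subF[OF e] cov[OF e] by (auto simp: card_2_iff)
    then show ?thesis
      using e w unfolding E1_def E2_def E3_def C'_def by (auto simp: insert_commute)
  qed
  have E12: "e \<notin> E2" "e \<notin> E3" if "e \<in> E1" for e
    using that by (auto simp: E1_def E2_def E3_def C'_def)
  have E23: "e \<notin> E3" if "e \<in> E2" for e
    using that by (auto simp: E2_def E3_def C'_def doubleton_eq_iff)
  have injimg: "inj_on ((`) f) (edges F)"
    using finj subF by (intro inj_onI) (metis inj_on_image_eq_iff)
  have D: "p \<subseteq> A \<and> card p = 2" if p: "p \<in> (`) f ` E1" for p
  proof -
    obtain e where e: "p = f ` e" "e \<in> edges F" "e \<subseteq> C'" using p by (auto simp: E1_def)
    then have "inj_on f e" using finj subF by (meson inj_on_subset)
    then show ?thesis using e fC' subF by (auto simp: card_image bij_betw_def)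
  qed
  have "card ((`) f ` E1) \<le> card E1" "card E1 \<le> card (edges F)" "finite E1"
    using finE by (auto intro!: card_image_le card_mono simp: E1_def)
  then have "card ((`) f ` E1) \<le> card Z" "finite ((`) f ` E1)" using Z(2) by auto
  then obtain \<psi> where \<psi>: "inj_on \<psi> ((`) f ` E1)"
    "\<And>e. e \<in> E1 \<Longrightarrow> f ` e \<subseteq> \<psi> (f ` e) \<and> \<psi> (f ` e) \<subseteq> A \<union> Z \<and> card (\<psi> (f ` e)) = k \<and>
      card (\<psi> (f ` e) - A) \<le> 1"
    using distinct_supersets_of_pairs[of A k "(`) f ` E1" Z] finA k A(3) D Z by auto
  \<comment> \<open>Here \<open>k \<le> card A\<close> enters: it gives k-1 < |A|, so that a
    (k-1)-set through each point of \<open>A\<close> plus one vertex outside is a core edge.\<close>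
  have "\<exists>c. inj_on c A \<and> (\<forall>a\<in>A. a \<in> c a \<and> c a \<subseteq> A \<and> card (c a) = k - 1)"
    using k A(3) by (intro distinct_subsets_through_points finA) auto
  then obtain c where c: "inj_on c A" "\<And>a. a \<in> A \<Longrightarrow> a \<in> c a \<and> c a \<subseteq> A \<and> card (c a) = k - 1"
    by blast
  \<comment> \<open>An edge is an unordered pair, so its hyperedge is chosen together with a
    decomposition into an end in \<open>C'\<close> and an end outside.\<close>
  have "\<forall>e\<in>E2. \<exists>g. \<exists>a\<in>C'. \<exists>x\<in>verts F - C'. e = {a, x} \<and> g = insert (f x) (c (f a))"
    unfolding E2_def by blast
  from bchoice[OF this] obtain \<chi> where "\<forall>e\<in>E2.
      \<exists>a\<in>C'. \<exists>x\<in>verts F - C'. e = {a, x} \<and> \<chi> e = insert (f x) (c (f a))" ..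
  note \<chi> = bspec[OF this]
  have "\<forall>e\<in>E3. \<exists>g. \<exists>x\<in>verts F - C. e = {w, x} \<and> g = h (f x)"
    unfolding E3_def by blast
  from bchoice[OF this] obtain \<omega> where "\<forall>e\<in>E3.
      \<exists>x\<in>verts F - C. e = {w, x} \<and> \<omega> e = h (f x)" ..
  note \<omega> = bspec[OF this]
  define \<phi> where "\<phi> e = (if e \<in> E1 then \<psi> (f ` e) else if e \<in> E2 then \<chi> e else \<omega> e)" for e
  have c_diff: "insert (f x) (c (f a)) - A = {f x}" if "a \<in> C'" "x \<in> verts F - C'" for a x
    using c(2)[of "f a"] fC' fA[of x] that by (auto simp: bij_betw_def)
  have phi1: "\<phi> e = \<psi> (f ` e)" if "e \<in> E1" for e using that by (simp add: \<phi>_def)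
  have phi2: "\<phi> e = \<chi> e" if "e \<in> E2" for e using that E12 by (auto simp: \<phi>_def)
  have phi3: "\<phi> e = \<omega> e" if "e \<in> E3" for e using that E12 E23 by (auto simp: \<phi>_def)
  have tr1: "\<phi> e - A \<subseteq> Z" "card (\<phi> e - A) \<le> 1" if "e \<in> E1" for e
    using \<psi>(2)[OF that] phi1[OF that] by auto
  have tr2: "\<exists>y. \<phi> e - A = {y} \<and> y \<notin> Z" if "e \<in> E2" for e
    using \<chi>[OF that] phi2[OF that] c_diff by (auto simp: Z_def)
  \<comment> \<open>The two vertices outside \<open>A\<close> are \<open>v\<close> and the
    representative \<open>f x\<close>.\<close>
  have tr3: "card (\<phi> e - A) \<ge> 2" if e: "e \<in> E3" for e
  proof -
    obtain x where x: "x \<in> verts F - C" "\<phi> e = h (f x)" using \<omega>[OF e] phi3[OF e] by auto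
    then have r: "f x \<in> R" using fR by (auto simp: bij_betw_def)
    then have "{f x, v} \<subseteq> \<phi> e - A" "f x \<noteq> v" using h(2) v R(1) x by auto
    moreover have "finite (\<phi> e)" using h(2)[OF r] x subH finH finite_subset by metis
    ultimately show ?thesis by (metis card_2_iff card_mono finite_Diff)
  qed
  have sep12: False if "e \<in> E1" "e' \<in> E2" "\<phi> e = \<phi> e'" for e e'
    using tr1(1)[OF that(1)] tr2[OF that(2)] that(3) by auto
  have sep13: False if "e \<in> E1" "e' \<in> E3" "\<phi> e = \<phi> e'" for e e'
    using tr1(2)[OF that(1)] tr3[OF that(2)] that(3) by simp
  have sep23: False if "e \<in> E2" "e' \<in> E3" "\<phi> e = \<phi> e'" for e e'
    using tr2[OF that(1)] tr3[OF that(2)] that(3) by auto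
  have "inj_on \<phi> (edges F)"
  proof (rule inj_onI)
    fix e e' assume ee: "e \<in> edges F" "e' \<in> edges F" "\<phi> e = \<phi> e'"
    consider "e \<in> E1" "e' \<in> E1" | "e \<in> E2" "e' \<in> E2" | "e \<in> E3" "e' \<in> E3"
      using split[OF ee(1)] split[OF ee(2)] sep12 sep13 sep23 ee(3) by metis
    then show "e = e'"
    proof cases
      case 1
      then have "f ` e = f ` e'" using ee phi1 \<psi>(1) by (metis image_eqI inj_onD)
      then show ?thesis using injimg ee by (auto dest: inj_onD)
    next
      case 2
      obtain a x where ax: "a \<in> C'" "x \<in> verts F - C'" "e = {a, x}"
        "\<phi> e = insert (f x) (c (f a))" using \<chi>[OF 2(1)] phi2[OF 2(1)] by auto
      obtain b y where by': "b \<in> C'" "y \<in> verts F - C'" "e' = {b, y}"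
        "\<phi> e' = insert (f y) (c (f b))" using \<chi>[OF 2(2)] phi2[OF 2(2)] by auto
      \<comment> \<open>The part of the hyperedge outside \<open>A\<close> recovers
        \<open>x\<close>; below, the part inside \<open>A\<close> is \<open>c (f a)\<close> and
        recovers \<open>a\<close>.\<close>
      have "f x = f y" using c_diff[OF ax(1,2)] c_diff[OF by'(1,2)] ax by' ee(3) by auto
      then have xy: "x = y" using finj ax by' by (auto dest: inj_onD)
      have fab: "f a \<in> A" "f b \<in> A" "f x \<notin> A"
        using ax by' fA fC' by (auto simp: bij_betw_def)
      then have "c (f a) = \<phi> e \<inter> A" "c (f b) = \<phi> e' \<inter> A"
        using c(2) ax by' xy by auto
      then have "f a = f b" using inj_onD[OF c(1) _ fab(1,2)] ee(3) by simp
      then have "a = b" using fC' ax by' by (auto simp: bij_betw_def dest: inj_onD)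
      then show ?thesis using xy ax by' by simp
    next
      case 3
      obtain x where x: "x \<in> verts F - C" "e = {w, x}" "\<phi> e = h (f x)"
        using \<omega>[OF 3(1)] phi3[OF 3(1)] by auto
      obtain y where y: "y \<in> verts F - C" "e' = {w, y}" "\<phi> e' = h (f y)"
        using \<omega>[OF 3(2)] phi3[OF 3(2)] by auto
      have "f x \<in> R" "f y \<in> R" using fR x y by (auto simp: bij_betw_def)
      then have "f x = f y" using h(1) ee(3) x y by (auto dest: inj_onD)
      then show ?thesis using finj x y by (auto dest: inj_onD)
    qed
  qed
  \<comment> \<open>Types \<open>E1\<close> and \<open>E2\<close> give core edges; for
    \<open>E3\<close> the hyperedges are among those supplied by \<open>h\<close>.\<close>
  moreover have "\<phi> e \<in> edges H \<and> f ` e \<subseteq> \<phi> e" if e: "e \<in> edges F" for e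
    using split[OF e]
  proof (elim disjE)
    assume e: "e \<in> E1"
    have "\<psi> (f ` e) \<subseteq> verts H" using \<psi>(2)[OF e] A(1) Z(4) by blast
    then show ?thesis using \<psi>(2)[OF e] phi1[OF e] core by simp
  next
    assume e: "e \<in> E2"
    obtain a x where ax: "a \<in> C'" "x \<in> verts F - C'" "e = {a, x}"
        "\<phi> e = insert (f x) (c (f a))" using \<chi>[OF e] phi2[OF e] by auto
    have fax: "f a \<in> A" "f x \<notin> A" using ax fA fC' by (auto simp: bij_betw_def)
    have "f x \<in> verts H" "finite (c (f a))" "f x \<notin> c (f a)"
      using fVH ax c(2)[OF fax(1)] finA fax finite_subset by auto
    then have "\<phi> e \<subseteq> verts H" "card (\<phi> e) = k"
      using c(2)[OF fax(1)] ax(4) A(1) k by auto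
    moreover have "card (\<phi> e - A) \<le> 1" using c_diff[OF ax(1,2)] ax(4) by simp
    ultimately show ?thesis using core ax c(2)[OF fax(1)] by auto
  next
    assume e: "e \<in> E3"
    obtain x where x: "x \<in> verts F - C" "e = {w, x}" "\<phi> e = h (f x)"
      using \<omega>[OF e] phi3[OF e] by auto
    then have "f x \<in> R" using fR by (auto simp: bij_betw_def)
    then show ?thesis using h(2) x fw by auto
  qed
  ultimately show ?thesis
    using H finj fVH by (intro contains_BergeI[of H f F \<phi>]) (auto simp: uniform_hypergraph_def)
qed

section \<open>Berge-freeness of the core and saturated extensions\<close>

text \<open>An edge of \<open>F\<close> missing the preimage \<open>B\<close> of \<open>A\<close>
  would have both ends mapped outside \<open>A\<close>, into a hyperedge with at most one vertex
  there. So \<open>B\<close> is a vertex cover, and injectivity makes it no larger than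
  \<open>A\<close>, too small for a cover.\<close>

lemma not_contains_Berge_core:
  assumes F: "finite_graph F" and A: "finite A" "card A < vertex_cover_number F"
    and H: "uniform_hypergraph k H" "\<And>e. e \<in> edges H \<Longrightarrow> card (e - A) \<le> 1"
  shows "\<not> contains_Berge F H"
proof
  assume "contains_Berge F H"
  then obtain f \<phi> where f: "inj_on f (verts F)"
    and \<phi>: "\<phi> ` edges F \<subseteq> edges H" "\<And>e. e \<in> edges F \<Longrightarrow> f ` e \<subseteq> \<phi> e"
    by (rule contains_BergeE) blast
  define B where "B = {x \<in> verts F. f x \<in> A}"
  have "e \<inter> B \<noteq> {}" if e: "e \<in> edges F" for e
  proof
    assume "e \<inter> B = {}"
    have eF: "e \<subseteq> verts F" "card e = 2"
      using F e by (auto simp: uniform_hypergraph_def finite_hypergraph_def)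
    then have "f ` e \<subseteq> \<phi> e - A"
      using \<open>e \<inter> B = {}\<close> \<phi>(2)[OF e] by (auto simp: B_def)
    moreover have "finite (\<phi> e)"
      using H(1) \<phi>(1) e finite_subset
      unfolding uniform_hypergraph_def finite_hypergraph_def by blast
    moreover have "card (f ` e) = 2" using f eF by (metis card_image inj_on_subset)
    ultimately have "2 \<le> card (\<phi> e - A)" by (metis card_mono finite_Diff)
    then show False using H(2)[of "\<phi> e"] \<phi>(1) e by auto
  qed
  then have "vertex_cover F B" by (auto simp: vertex_cover_def B_def)
  then have "vertex_cover_number F \<le> card B"
    unfolding vertex_cover_number_def by (intro Least_le) auto
  also have "card B \<le> card A"
  proof (rule card_inj_on_le[of f])
    show "inj_on f B" using f by (rule inj_on_subset) (auto simp: B_def)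
  qed (use A in \<open>auto simp: B_def\<close>)
  finally show False using A(2) by simp
qed

text \<open>There are finitely many edge sets on \<open>V\<close>, and an inclusion-maximal
  Berge-free one above \<open>E0\<close> is saturated.\<close>

lemma maximal_Berge_free_extension:
  assumes "uniform_hypergraph k (V, E0)" "\<not> contains_Berge F (V, E0)"
  shows "\<exists>E. E0 \<subseteq> E \<and> Berge_saturated k F (V, E)"
proof -
  define S where "S = {E. uniform_hypergraph k (V, E) \<and> \<not> contains_Berge F (V, E)}"
  have "finite V" using assms(1) by (auto simp: uniform_hypergraph_def finite_hypergraph_def)
  moreover have "S \<subseteq> Pow (Pow V)"
    by (auto simp: S_def uniform_hypergraph_def finite_hypergraph_def)
  ultimately have fin: "finite S" by (meson finite_Pow_iff finite_subset)
  have "E0 \<in> S" using assms by (simp add: S_def)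
  then obtain E where E: "E \<in> S" "E0 \<subseteq> E" and maxE: "\<And>E'. E' \<in> S \<Longrightarrow> E \<subseteq> E' \<Longrightarrow> E = E'"
    using finite_has_maximal2[OF fin] by metis
  have "contains_Berge F (V, insert e E)" if e: "e \<subseteq> V" "card e = k" "e \<notin> E" for e
  proof -
    have "insert e E \<notin> S" using maxE[of "insert e E"] e by auto
    moreover have "uniform_hypergraph k (V, insert e E)"
      using E e by (auto simp: S_def uniform_hypergraph_def finite_hypergraph_def)
    ultimately show ?thesis by (simp add: S_def)
  qed
  then show ?thesis using E by (auto simp: Berge_saturated_def S_def)
qed

section \<open>Bounded degree outside the core\<close>

text \<open>Assign to each covered point some edge through it. An edge serves at most
  \<open>k\<close> points, so at least \<open>d\<close> different edges are used; keeping one point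
  for each of \<open>d\<close> of them makes the assignment injective.\<close>

lemma distinct_edges_through_points:
  assumes "0 < k" "finite X" "\<And>e. e \<in> X \<Longrightarrow> finite e \<and> card e \<le> k"
    and "k * d \<le> card (\<Union>X - B)"
  shows "\<exists>R h. R \<subseteq> \<Union>X - B \<and> card R = d \<and> inj_on h R \<and> (\<forall>r\<in>R. h r \<in> X \<and> r \<in> h r)"
proof -
  define W where "W = \<Union>X - B"
  have finW: "finite W" using assms(2,3) by (auto simp: W_def)
  have "\<forall>u\<in>W. \<exists>e. e \<in> X \<and> u \<in> e" by (auto simp: W_def)
  then obtain h where h: "\<And>u. u \<in> W \<Longrightarrow> h u \<in> X \<and> u \<in> h u" by metis
  have "W \<subseteq> \<Union>(h ` W)" using h by auto
  then have "card W \<le> card (\<Union>(h ` W))"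
    using finW h assms(3) by (intro card_mono) auto
  also have "\<dots> \<le> (\<Sum>e\<in>h ` W. card e)" by (rule card_Union_le_sum_card)
  also have "\<dots> \<le> (\<Sum>e\<in>h ` W. k)" using h assms(3) by (intro sum_mono) auto
  finally have "card W \<le> k * card (h ` W)" by (simp add: mult.commute)
  then have "k * d \<le> k * card (h ` W)" using assms(4) unfolding W_def by linarith
  then have "d \<le> card (h ` W)" using assms(1) by simp
  \<comment> \<open>\<open>S\<close> picks one point from each fibre of \<open>h\<close>.\<close>
  moreover obtain S where S: "S \<subseteq> W" "inj_on h S" "h ` W = h ` S"
    using subset_image_inj[of "h ` W" h W] by auto
  ultimately have "d \<le> card S" by (simp add: card_image)
  then obtain R where R: "R \<subseteq> S" "card R = d" by (meson obtain_subset_with_card_n)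
  then have "R \<subseteq> W" "inj_on h R" using S by (auto intro: inj_on_subset)
  then show ?thesis using R(2) h unfolding W_def by blast
qed

text \<open>If the non-core edges at \<open>v\<close> covered many points besides \<open>A\<close>
  and \<open>v\<close>, they would supply the representatives for \<open>Berge_embedding\<close>. So
  all of them are subsets of one set of bounded size, and the bound counts its subsets.\<close>

lemma card_edges_outside_core_at_vertex_le:
  fixes H :: "'b hypergraph"
  assumes k: "2 \<le> k" and H: "uniform_hypergraph k H" and F: "finite_graph F"
    and cover: "vertex_cover_number F = Suc (card A)"
    and A: "A \<subseteq> verts H" "k \<le> card A"
    and core: "\<And>e. \<lbrakk>e \<subseteq> verts H; card e = k; card (e - A) \<le> 1\<rbrakk> \<Longrightarrow> e \<in> edges H"
    and v: "v \<in> verts H - A"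
    and large: "card (verts F) + card (edges F) \<le> card (verts H)"
    and free: "\<not> contains_Berge F H"
  shows "card {e \<in> edges H. v \<in> e \<and> 2 \<le> card (e - A)} \<le> 2 ^ (k * card (verts F) + card A + 1)"
proof -
  define X where "X = {e \<in> edges H. v \<in> e \<and> 2 \<le> card (e - A)}"
  define W where "W = \<Union>X - insert v A"
  have finH: "finite (verts H)" and subH: "\<And>e. e \<in> edges H \<Longrightarrow> e \<subseteq> verts H \<and> card e = k"
    using H by (auto simp: uniform_hypergraph_def finite_hypergraph_def)
  have finX: "finite X"
    using subH finH by (intro finite_subset[of X "Pow (verts H)"]) (auto simp: X_def)
  have Xe: "finite e \<and> card e \<le> k" if "e \<in> X" for e
    using that subH[of e] finite_subset[OF _ finH, of e] by (simp add: X_def)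
  have WH: "W \<subseteq> verts H" using subH by (auto simp: W_def X_def)
  have finV: "finite (verts F)"
    using F by (auto simp: uniform_hypergraph_def finite_hypergraph_def)
  have fin: "finite (W \<union> insert v A)" "finite A" using finH A(1) WH finite_subset by auto
  obtain C where C: "vertex_cover F C" "card C = Suc (card A)"
    using vertex_cover_number_attained[OF F] cover by auto
  then obtain w where w: "w \<in> C" by fastforce
  have "\<not> k * card (verts F - C) \<le> card W"
  proof
    assume "k * card (verts F - C) \<le> card W"
    then obtain R h where R: "R \<subseteq> W" "card R = card (verts F - C)" "inj_on h R"
      "\<forall>r\<in>R. h r \<in> X \<and> r \<in> h r"
      using distinct_edges_through_points[of k X "card (verts F - C)" "insert v A"]
        finX Xe k by (auto simp: W_def)
    have "contains_Berge F H"
    proof (rule Berge_embedding[OF k H F C(1) w A(1) _ A(2) core v _ R(2,3) _ large])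
      show "card A = card (C - {w})" using C(2) w by simp
      show "R \<subseteq> verts H - A - {v}" using R(1) WH by (auto simp: W_def)
      show "h r \<in> edges H \<and> r \<in> h r \<and> v \<in> h r" if "r \<in> R" for r
        using R(4) that by (auto simp: X_def)
    qed
    then show False using free by simp
  qed
  \<comment> \<open>Passing from \<open>verts F - C\<close> to \<open>verts F\<close> frees the
    bound from the choice of the cover.\<close>
  then have "card W \<le> k * card (verts F - C)" by simp
  also have "\<dots> \<le> k * card (verts F)" using finV by (intro mult_le_mono card_mono) auto
  finally have W: "card W \<le> k * card (verts F)" .
  have "card (W \<union> insert v A) \<le> card W + card (insert v A)" by (rule card_Un_le)
  then have "card (W \<union> insert v A) \<le> k * card (verts F) + card A + 1"
    using W v fin(2) by auto
  moreover have "card X \<le> card (Pow (W \<union> insert v A))"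
    using fin by (intro card_mono) (auto simp: W_def)
  ultimately show ?thesis
    using fin by (fold X_def) (simp only: card_Pow, meson one_le_numeral order_trans power_increasing)
qed

section \<open>Edge count and the linear bound\<close>

text \<open>Such a set is determined by its part in \<open>A\<close>, with 2^|A| choices, and its
  part outside, which is empty or a single vertex of \<open>V\<close>.\<close>

lemma card_core_le:
  assumes "finite V" "finite A"
  shows "card {e. e \<subseteq> V \<and> card (e - A) \<le> 1} \<le> 2 ^ card A * (card V + 1)"
proof -
  define P where "P = insert {} ((\<lambda>x. {x}) ` V)"
  have "{e. e \<subseteq> V \<and> card (e - A) \<le> 1} \<subseteq> (\<lambda>(S, Y). S \<union> Y) ` (Pow A \<times> P)"
  proof
    fix e assume "e \<in> {e. e \<subseteq> V \<and> card (e - A) \<le> 1}"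
    then have e: "e \<subseteq> V" "card (e - A) \<le> 1" by auto
    then have "finite (e - A)" using assms(1) finite_subset by auto
    then have "e - A = {} \<or> (\<exists>x. e - A = {x})"
      using e(2) by (metis card_1_singletonE card_eq_0_iff le_antisym less_one not_less)
    then have "e - A \<in> P" using e(1) by (auto simp: P_def)
    then show "e \<in> (\<lambda>(S, Y). S \<union> Y) ` (Pow A \<times> P)"
      by (intro image_eqI[of _ _ "(e \<inter> A, e - A)"]) auto
  qed
  moreover have finP: "finite P" using assms(1) by (simp add: P_def)
  ultimately have "card {e. e \<subseteq> V \<and> card (e - A) \<le> 1} \<le> card (Pow A \<times> P)"
    using assms(2) by (meson card_image_le card_mono finite_Pow_iff finite_SigmaI finite_imageI order_trans)
  also have "\<dots> = 2 ^ card A * card P" using assms(2) by (simp add: card_cartesian_product card_Pow)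
  also have "card P \<le> card V + 1"
    using card_insert_le_m1[of "Suc (card V)" "(\<lambda>x. {x}) ` V" "{}"] card_image_le[OF assms(1), of "\<lambda>x. {x}"]
    by (simp add: P_def)
  finally show ?thesis by simp
qed

text \<open>The first summand bounds the core. The second bounds all other edges by adding up, over
  the vertices outside \<open>A\<close>, the non-core edges at each. The lower bound on
  \<open>n\<close> leaves room for \<open>A\<close> and for the embedding.\<close>

lemma Berge_sat_le:
  fixes F :: "'a hypergraph"
  assumes k: "2 \<le> k" and F: "finite_graph F" and cover: "vertex_cover_number F = Suc s" "k \<le> s"
    and n: "card (verts F) + card (edges F) + s \<le> n"
  shows "Berge_sat k n F \<le> 2 ^ s * (n + 1) + n * 2 ^ (k * card (verts F) + s + 1)"
proof -
  define V where "V = {..<n}"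
  define A where "A = {..<s}"
  define E0 where "E0 = {e. e \<subseteq> V \<and> card e = k \<and> card (e - A) \<le> 1}"
  have VA: "finite V" "card V = n" "finite A" "card A = s" "A \<subseteq> V"
    using n by (auto simp: V_def A_def)
  have H0: "uniform_hypergraph k (V, E0)"
    using VA(1) by (auto simp: uniform_hypergraph_def finite_hypergraph_def E0_def)
  then have "\<not> contains_Berge F (V, E0)"
    using cover(1) VA by (intro not_contains_Berge_core[OF F VA(3) _ H0]) (auto simp: E0_def)
  then obtain E where E: "E0 \<subseteq> E" "Berge_saturated k F (V, E)"
    using maximal_Berge_free_extension[OF H0] by blast
  have H: "uniform_hypergraph k (V, E)" "\<not> contains_Berge F (V, E)"
    using E(2) by (auto simp: Berge_saturated_def)
  define X where "X v = {e \<in> E. v \<in> e \<and> 2 \<le> card (e - A)}" for v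
  have Esub: "e \<subseteq> V \<and> card e = k" if "e \<in> E" for e
    using H(1) that by (auto simp: uniform_hypergraph_def finite_hypergraph_def)
  then have finE: "finite E" using VA(1) by (intro finite_subset[of E "Pow V"]) auto
  \<comment> \<open>A non-core edge has a vertex \<open>v\<close> outside \<open>A\<close> and is
    therefore counted in \<open>X v\<close>.\<close>
  have "e \<in> E0 \<union> (\<Union>v\<in>V - A. X v)" if e: "e \<in> E" for e
  proof (cases "card (e - A) \<le> 1")
    case False
    then have "e - A \<noteq> {}" by (metis card.empty zero_le)
    then obtain v where "v \<in> e - A" by blast
    then show ?thesis using e Esub[OF e] False by (auto simp: X_def)
  qed (use Esub[OF e] in \<open>auto simp: E0_def\<close>)
  then have "card E \<le> card (E0 \<union> (\<Union>v\<in>V - A. X v))"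
    using finE E(1) VA(1) by (intro card_mono) (auto simp: X_def intro: finite_subset)
  also have "\<dots> \<le> card E0 + card (\<Union>v\<in>V - A. X v)" by (rule card_Un_le)
  also have "card E0 \<le> card {e. e \<subseteq> V \<and> card (e - A) \<le> 1}"
    using VA(1) by (intro card_mono) (auto simp: E0_def)
  also have "\<dots> \<le> 2 ^ s * (n + 1)" using card_core_le[OF VA(1,3)] VA by simp
  also have "card (\<Union>v\<in>V - A. X v) \<le> (\<Sum>v\<in>V - A. card (X v))"
    using VA(1) by (intro card_UN_le) auto
  also have "\<dots> \<le> (\<Sum>v\<in>V - A. 2 ^ (k * card (verts F) + s + 1))"
  proof (rule sum_mono)
    fix v assume "v \<in> V - A"
    then show "card (X v) \<le> 2 ^ (k * card (verts F) + s + 1)"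
      using card_edges_outside_core_at_vertex_le[OF k H(1) F, of A v] cover VA n E(1) H(2)
      by (auto simp: X_def E0_def)
  qed
  also have "\<dots> \<le> (\<Sum>v\<in>V. 2 ^ (k * card (verts F) + s + 1))"
    using VA(1) by (intro sum_mono2) auto
  finally have "card E \<le> 2 ^ s * (n + 1) + n * 2 ^ (k * card (verts F) + s + 1)"
    using VA by simp
  moreover have "Berge_sat k n F \<le> card E"
    unfolding Berge_sat_def
    by (intro Least_le exI[of _ "(V, E)"]) (use E(2) VA in auto)
  ultimately show ?thesis by linarith
qed

theorem theorem2p4:
  fixes k :: nat and F :: "'a hypergraph"
  assumes "k \<ge> 2"
    and "finite_graph F"
    and "vertex_cover_number F \<ge> k + 1"
  shows "(\<lambda>n. real (Berge_sat k n F)) \<in> O(\<lambda>n. real n)"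
proof -
  obtain s where s: "vertex_cover_number F = Suc s" "k \<le> s"
    using assms(3) by (cases "vertex_cover_number F") auto
  define M where "M = (2::nat) ^ (k * card (verts F) + s + 1)"
  show ?thesis
  proof (rule bigoI[where c = "real (2 ^ s * 2 + M)"])
    show "\<forall>\<^sub>F n in sequentially.
      norm (real (Berge_sat k n F)) \<le> real (2 ^ s * 2 + M) * norm (real n)"
      \<comment> \<open>The extra 1 in the threshold makes \<open>n\<close> positive, so that n+1
        \<le> 2n absorbs the additive term.\<close>
      using eventually_ge_at_top[of "card (verts F) + card (edges F) + s + 1"]
    proof eventually_elim
      case (elim n)
      then have "Berge_sat k n F \<le> 2 ^ s * (n + 1) + n * M"
        using Berge_sat_le[OF assms(1,2) s] by (simp add: M_def)
      also have "\<dots> \<le> 2 ^ s * (2 * n) + n * M"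
        using elim by (intro add_mono mult_le_mono) auto
      also have "\<dots> = (2 ^ s * 2 + M) * n" by (simp add: algebra_simps)
      finally show ?case by (metis norm_of_nat of_nat_le_iff of_nat_mult)
    qed
  qed
qed

end
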